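(* Let $K \ge 2$ be an integer and let $\alpha \in [0,1]$. Let $(X,Y,Z),(X_1,Y_1,Z_1),(X_2,Y_2,Z_2),\dots$ be i.i.d., where $X$ takes values in $\mathbb{R}^d$, the true label $Y$ takes values in $[K]=\{1,\dots,K\}$, and the noisy label $Z$ takes values in $[K]$ and is obtained from $Y$ by symmetric label noise with noise probability $\alpha$, i.e. $\mathbb{P}[Z=k\mid Y=k, X]=1-\alpha$ and $\mathbb{P}[Z=l\mid Y=k, X]=\frac{\alpha}{K-1}$ for $l\ne k$. Let $q_k(x)=\mathbb{P}[Z=k\mid X=x]$, and let $q_{kn}$ ($k\in[K]$, $n\ge 1$) be estimates of $q_k$ built from the noisy training data $\tilde{\mathcal{T}}_n=\{(X_1,Z_1),\dots,(X_n,Z_n)\}$ that are $L_1$-consistent: $$\lim_{n\to\infty}\mathbb{E}\Big(\sum_{k=1}^K |q_{kn}(X)-q_k(X)|\Big)=0 .$$ Let $\tilde g_n(x)=\arg\max_{k\in[K]} q_{kn}(x)$ be the plug-in classifier. If $\alpha<\frac{K-1}{K}$, then, whether $\alpha$ is known or unknown (the rule $\tilde g_n$ itself makes no use of the value of $\alpha$), $$L(\tilde g_n)\to L(g^* )\quad\text{in probability as } n\to\infty,$$ where $L(\tilde g_n)=\mathbb{P}[\tilde g_n(X)\ne Y\mid \tilde{\mathcal{T}}_n]$ is the error probability with respect to the clean label $Y$ and $L(g^* )$ is the Bayes error for predicting $Y$ from $X$.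
   Context: The pair $(X,Y)$ is a test point independent of the training data. Each $q_{kn}(x)=q_{kn}(x;\tilde{\mathcal{T}}_n)$ is a real-valued (jointly measurable) function of the point $x\in\mathbb{R}^d$ and of the noisy training data; the expectation in the definition of $L_1$-consistency is over both $X$ and $\tilde{\mathcal{T}}_n$. Ties in the $\arg\max$ are broken by any fixed measurable rule. With $p_k(x)=\mathbb{P}[Y=k\mid X=x]$, the Bayes classifier is $g^*(x)=\arg\max_{k\in[K]}p_k(x)$, and the Bayes error is $L(g^* )=\mathbb{P}[g^*(X)\ne Y]=1-\mathbb{E}[\max_k p_k(X)]$. *)

theory Defs
  imports "HOL-Probability.Probability"
begin

definition iid :: "'w measure \<Rightarrow> 'b measure \<Rightarrow> ('i \<Rightarrow> 'w \<Rightarrow> 'b) \<Rightarrow> bool" where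
  "iid M S V \<longleftrightarrow> prob_space.indep_vars M (\<lambda>_. S) V UNIV \<and>
     (\<forall>i j. distr M S (V i) = distr M S (V j))"

(* P[E | V] as a random variable, where V is a random element of the measurable space N *)
definition cond_prob_rv ::
  "'w measure \<Rightarrow> 'b measure \<Rightarrow> ('w \<Rightarrow> 'b) \<Rightarrow> 'w set \<Rightarrow> 'w \<Rightarrow> real" where
  "cond_prob_rv M N V E =
     real_cond_exp M (vimage_algebra (space M) V N) (indicator E)"

(* f is a version of the regression function v \<mapsto> P[E | V = v] *)
definition is_cond_prob_at ::
  "'w measure \<Rightarrow> 'b measure \<Rightarrow> ('w \<Rightarrow> 'b) \<Rightarrow> 'w set \<Rightarrow> ('b \<Rightarrow> real) \<Rightarrow> bool" where
  "is_cond_prob_at M N V E f \<longleftrightarrow>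
     f \<in> borel_measurable N \<and> (AE w in M. f (V w) = cond_prob_rv M N V E w)"

definition tendsto_in_prob :: "'w measure \<Rightarrow> (nat \<Rightarrow> 'w \<Rightarrow> real) \<Rightarrow> real \<Rightarrow> bool" where
  "tendsto_in_prob M F l \<longleftrightarrow>
     (\<forall>\<epsilon>>0. (\<lambda>n. measure M {w \<in> space M. \<bar>F n w - l\<bar> > \<epsilon>}) \<longlonglongrightarrow> 0)"

(* The label space [K]. As its space is {1..K}, measurability into it includes
   that the values lie in {1..K}. *)
abbreviation labels :: "nat \<Rightarrow> nat measure" where
  "labels K \<equiv> count_space {1..K}"

abbreviation train_space :: "nat \<Rightarrow> nat \<Rightarrow> (nat \<Rightarrow> (real^'d) \<times> nat) measure" where
  "train_space K n \<equiv> (\<Pi>\<^sub>M i\<in>{1..n}. borel \<Otimes>\<^sub>M labels K)"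

definition noisy_train ::
  "(nat \<Rightarrow> 'w \<Rightarrow> real^'d) \<Rightarrow> (nat \<Rightarrow> 'w \<Rightarrow> nat) \<Rightarrow> nat \<Rightarrow> 'w \<Rightarrow> nat \<Rightarrow> (real^'d) \<times> nat" where
  "noisy_train Xs Zs n w = (\<lambda>i\<in>{1..n}. (Xs i w, Zs i w))"

definition symmetric_label_noise ::
  "'w measure \<Rightarrow> nat \<Rightarrow> real \<Rightarrow> ('w \<Rightarrow> real^'d) \<Rightarrow> ('w \<Rightarrow> nat) \<Rightarrow> ('w \<Rightarrow> nat) \<Rightarrow> bool" where
  "symmetric_label_noise M K \<alpha> X Y Z \<longleftrightarrow>
     (\<forall>l\<in>{1..K}. AE w in M.
        cond_prob_rv M (borel \<Otimes>\<^sub>M labels K) (\<lambda>w. (X w, Y w)) {w \<in> space M. Z w = l} w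
          = (if l = Y w then 1 - \<alpha> else \<alpha> / (real K - 1)))"

definition classification_error ::
  "'w measure \<Rightarrow> ('w \<Rightarrow> 'x) \<Rightarrow> ('w \<Rightarrow> nat) \<Rightarrow> ('x \<Rightarrow> nat) \<Rightarrow> real" where
  "classification_error M X Y g = measure M {w \<in> space M. g (X w) \<noteq> Y w}"

end

(* Symmetric noise acts affinely on the class probabilities: conditioning on X gives
   q_k = alpha / (K - 1) + b p_k with b = 1 - alpha K / (K - 1), and b > 0 exactly when
   alpha < (K - 1) / K. So b times the excess error of a plug-in rule for fixed training data t is at
   most the integral of sum_k |q_kn(x; t) - q_k(x)| over the law of X. Since the test triple is
   independent of the training data, the conditional error given T is the error of the fixed rule
   at t = T, which is never below the Bayes error, and Markov's inequality
   turns L1-consistency into convergence in probability. *)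
theory Submission
  imports Defs
begin

section \<open>Conditional probabilities given a random element\<close>

lemma vimage_algebra_subalgebra:
  assumes "V \<in> M \<rightarrow>\<^sub>M N"
  shows "subalgebra M (vimage_algebra (space M) V N)"
  using sets_image_in_sets[OF refl assms] by (simp add: subalgebra_def)

context prob_space
begin

lemma sigma_finite_vimage_subalgebra:
  assumes "V \<in> M \<rightarrow>\<^sub>M N"
  shows "sigma_finite_subalgebra M (vimage_algebra (space M) V N)"
  by (intro finite_measure_subalgebra_is_sigma_finite finite_measure_subalgebra.intro
      finite_measure_subalgebra_axioms.intro vimage_algebra_subalgebra assms finite_measure_axioms)

lemma integrable_cond_prob_at:
  assumes V: "V \<in> M \<rightarrow>\<^sub>M N" and E: "E \<in> events" and f: "is_cond_prob_at M N V E f"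
  shows "integrable M (\<lambda>w. f (V w))"
proof -
  interpret S: sigma_finite_subalgebra M "vimage_algebra (space M) V N"
    by (rule sigma_finite_vimage_subalgebra[OF V])
  have fm: "f \<in> borel_measurable N"
    and fe: "AE w in M. f (V w) = cond_prob_rv M N V E w"
    using f by (auto simp: is_cond_prob_at_def)
  have "integrable M (cond_prob_rv M N V E)"
    unfolding cond_prob_rv_def using E by (intro S.real_cond_exp_int(1) integrable_indicator_iff[THEN iffD2]) (auto simp: emeasure_eq_measure)
  then show ?thesis
    using fe V fm by (subst integrable_cong_AE[where g = "cond_prob_rv M N V E"]) (auto dest: borel_measurable_integrable)
qed

lemma integral_cond_prob_at:
  assumes V: "V \<in> M \<rightarrow>\<^sub>M N" and E: "E \<in> events" and f: "is_cond_prob_at M N V E f"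
    and A: "A \<in> sets N"
  shows "(\<integral>w. indicator A (V w) * f (V w) \<partial>M) = prob ({w \<in> space M. V w \<in> A} \<inter> E)"
proof -
  interpret S: sigma_finite_subalgebra M "vimage_algebra (space M) V N"
    by (rule sigma_finite_vimage_subalgebra[OF V])
  let ?A = "V -` A \<inter> space M"
  have A': "?A \<in> sets (vimage_algebra (space M) V N)" by (rule in_vimage_algebra[OF A])
  have fm: "f \<in> borel_measurable N"
    and fe: "AE w in M. f (V w) = real_cond_exp M (vimage_algebra (space M) V N) (indicator E) w"
    using f by (auto simp: is_cond_prob_at_def cond_prob_rv_def)
  have "(\<integral>w. indicator A (V w) * f (V w) \<partial>M) =
      (\<integral>w\<in>?A. real_cond_exp M (vimage_algebra (space M) V N) (indicator E) w \<partial>M)"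
    unfolding set_lebesgue_integral_def
  proof (rule integral_cong_AE)
    show "(\<lambda>w. indicator A (V w) * f (V w)) \<in> borel_measurable M"
      using V fm A by measurable
    show "(\<lambda>w. indicator ?A w *\<^sub>R real_cond_exp M (vimage_algebra (space M) V N) (indicator E) w) \<in> borel_measurable M"
      using V A by measurable
    show "AE w in M. indicator A (V w) * f (V w) =
        indicator ?A w *\<^sub>R real_cond_exp M (vimage_algebra (space M) V N) (indicator E) w"
      using fe AE_space by eventually_elim (auto simp: indicator_def)
  qed
  also have "\<dots> = (\<integral>w\<in>?A. indicator E w \<partial>M)"
    using E by (intro S.real_cond_exp_intA[OF _ A', symmetric]) (simp add: emeasure_eq_measure)
  also have "\<dots> = (\<integral>w. indicator (?A \<inter> E) w \<partial>M)"
    unfolding set_lebesgue_integral_def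
    by (intro Bochner_Integration.integral_cong) (auto simp: indicator_def)
  also have "\<dots> = prob (?A \<inter> E)"
    using E V A by (auto intro!: arg_cong[where f = prob])
  finally show ?thesis by (simp add: vimage_def Int_def conj_commute)
qed

section \<open>Error probability of a fixed classifier\<close>

text \<open>Given \<open>X\<close>, a fixed rule is correct with conditional probability
  \<open>p (g (X w)) (X w)\<close>. The label in that expression varies with \<open>w\<close>, so
  the space is split into the finitely many regions where \<open>g\<close> is constant; on each one
  the averaging identity for a single class applies.\<close>

lemma integrable_cond_prob_at_select:
  fixes Y :: "'a \<Rightarrow> nat"
  assumes X: "X \<in> M \<rightarrow>\<^sub>M N" and Y: "Y \<in> M \<rightarrow>\<^sub>M labels K" and g: "g \<in> N \<rightarrow>\<^sub>M labels K"
    and p: "\<And>k. k \<in> {1..K} \<Longrightarrow> is_cond_prob_at M N X {w \<in> space M. Y w = k} (p k)"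
  shows "integrable M (\<lambda>w. p (g (X w)) (X w))" (is ?int)
    and "classification_error M X Y g = 1 - (\<integral>w. p (g (X w)) (X w) \<partial>M)" (is ?err)
proof -
  have gl: "g x \<in> {1..K}" if "x \<in> space N" for x using measurable_space[OF g that] by simp
  have Xs: "X w \<in> space N" if "w \<in> space M" for w using measurable_space[OF X that] .
  have E: "{w \<in> space M. Y w = k} \<in> events" if "k \<in> {1..K}" for k
    using measurable_sets[OF Y, of "{k}"] that by (simp add: vimage_def Int_def conj_commute)
  define A where "A k = g -` {k} \<inter> space N" for k
  have A: "A k \<in> sets N" if "k \<in> {1..K}" for k
    unfolding A_def using that by (intro measurable_sets[OF g]) auto
  have eq: "p (g (X w)) (X w) = (\<Sum>k=1..K. indicator (A k) (X w) * p k (X w))" if "w \<in> space M" for w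
  proof -
    have "(\<Sum>k=1..K. indicator (A k) (X w) * p k (X w)) = (\<Sum>k=1..K. if k = g (X w) then p k (X w) else 0)"
      using Xs[OF that] by (intro sum.cong) (auto simp: A_def)
    then show ?thesis using gl[OF Xs[OF that]] by (simp add: sum.delta)
  qed
  have ik: "integrable M (\<lambda>w. indicator (A k) (X w) * p k (X w))" if k: "k \<in> {1..K}" for k
  proof -
    have "integrable M (\<lambda>w. indicator (X -` A k \<inter> space M) w *\<^sub>R p k (X w))"
      by (intro integrable_mult_indicator integrable_cond_prob_at[OF X E[OF k] p[OF k]] measurable_sets[OF X A[OF k]])
    then show ?thesis
      by (rule Bochner_Integration.integrable_cong[THEN iffD1, rotated -1]) (auto simp: indicator_def)
  qed
  show ?int
    by (subst Bochner_Integration.integrable_cong[OF refl eq]) (assumption | intro Bochner_Integration.integrable_sum ik)+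
  have "(\<integral>w. p (g (X w)) (X w) \<partial>M) = (\<Sum>k=1..K. \<integral>w. indicator (A k) (X w) * p k (X w) \<partial>M)"
    by (subst Bochner_Integration.integral_cong[OF refl eq]) (assumption | intro Bochner_Integration.integral_sum ik)+
  also have "\<dots> = (\<Sum>k=1..K. prob ({w \<in> space M. X w \<in> A k} \<inter> {w \<in> space M. Y w = k}))"
    by (intro sum.cong refl integral_cond_prob_at[OF X E p A])
  also have "\<dots> = prob (\<Union>k\<in>{1..K}. {w \<in> space M. X w \<in> A k} \<inter> {w \<in> space M. Y w = k})"
    using E measurable_sets_Collect[OF X, of "\<lambda>x. x \<in> A k" for k] A
    by (intro finite_measure_finite_Union[symmetric])
       (auto simp: disjoint_family_on_def intro!: sets.Int measurable_sets_Collect[OF X])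
  \<comment> \<open>Both \<open>g\<close> and \<open>Y\<close> take values in {1..K} only, so the
    union over these labels covers every agreement of the two.\<close>
  also have B: "(\<Union>k\<in>{1..K}. {w \<in> space M. X w \<in> A k} \<inter> {w \<in> space M. Y w = k}) =
      {w \<in> space M. g (X w) = Y w}"
    using measurable_space[OF Y] Xs by (auto simp: A_def)
  also have "prob \<dots> = 1 - prob {w \<in> space M. g (X w) \<noteq> Y w}"
  proof -
    have "{w \<in> space M. g (X w) = Y w} \<in> events"
      unfolding B[symmetric] using E A by (auto intro!: sets.Int measurable_sets_Collect[OF X])
    then show ?thesis by (simp add: prob_neg)
  qed
  finally show ?err by (simp add: classification_error_def)
qed

section \<open>Conditioning on an independent random element\<close>

text \<open>Tonelli's theorem pulled back to \<open>M\<close>. Independence enters as the equality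
  \<open>ind\<close> of joint law and product of marginals, and the inner integral runs over an
  independent copy \<open>v\<close> of the sample point.\<close>

lemma nn_integral_product_distr:
  assumes V[measurable]: "V \<in> M \<rightarrow>\<^sub>M S" and T[measurable]: "T \<in> M \<rightarrow>\<^sub>M N"
    and ind: "distr M S V \<Otimes>\<^sub>M distr M N T = distr M (S \<Otimes>\<^sub>M N) (\<lambda>w. (V w, T w))"
    and f: "f \<in> borel_measurable (S \<Otimes>\<^sub>M N)"
  shows "(\<integral>\<^sup>+w. f (V w, T w) \<partial>M) = (\<integral>\<^sup>+w. (\<integral>\<^sup>+v. f (V v, T w) \<partial>M) \<partial>M)"
proof -
  interpret V: prob_space "distr M S V" by (rule prob_space_distr[OF V])
  interpret T: prob_space "distr M N T" by (rule prob_space_distr[OF T])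
  interpret P: pair_prob_space "distr M S V" "distr M N T" ..
  note f[measurable]
  have f': "f \<in> borel_measurable (distr M S V \<Otimes>\<^sub>M distr M N T)"
    by measurable
  have "(\<integral>\<^sup>+w. f (V w, T w) \<partial>M) = integral\<^sup>N (distr M (S \<Otimes>\<^sub>M N) (\<lambda>x. (V x, T x))) f"
    by (subst nn_integral_distr) auto
  also have "\<dots> = (\<integral>\<^sup>+ t. (\<integral>\<^sup>+ v. f (v, t) \<partial>distr M S V) \<partial>distr M N T)"
    unfolding ind[symmetric] by (rule P.nn_integral_snd[OF f', symmetric])
  also have "\<dots> = (\<integral>\<^sup>+ w. (\<integral>\<^sup>+ v. f (v, T w) \<partial>distr M S V) \<partial>M)"
  proof (rule nn_integral_distr[OF T])
    show "(\<lambda>t. \<integral>\<^sup>+ v. f (v, t) \<partial>distr M S V) \<in> borel_measurable (distr M N T)"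
      by (rule V.borel_measurable_nn_integral) simp
  qed
  also have "\<dots> = (\<integral>\<^sup>+w. (\<integral>\<^sup>+v. f (V v, T w) \<partial>M) \<partial>M)"
    by (intro nn_integral_cong nn_integral_distr[OF V]) (auto intro!: measurable_compose[OF _ f] measurable_Pair measurable_space[OF T])
  finally show ?thesis .
qed

lemma borel_measurable_prob_section:
  assumes V[measurable]: "V \<in> M \<rightarrow>\<^sub>M S" and C[measurable]: "C \<in> sets (S \<Otimes>\<^sub>M N)"
  shows "(\<lambda>t. prob {v \<in> space M. (V v, t) \<in> C}) \<in> borel_measurable N"
proof -
  \<comment> \<open>As an integral depending on the parameter \<open>t\<close>, the section
    probability inherits measurability from the jointly measurable integrand.\<close>
  have "(\<lambda>t. \<integral>v. indicat_real C (V v, t) \<partial>M) \<in> borel_measurable N"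
    by measurable
  also have "?this \<longleftrightarrow> ?thesis"
  proof (rule measurable_cong)
    fix t assume t: "t \<in> space N"
    have ev: "{v \<in> space M. (V v, t) \<in> C} \<in> events"
      using V C t by measurable
    have "(\<integral>v. indicat_real C (V v, t) \<partial>M) = (\<integral>v. indicator {v \<in> space M. (V v, t) \<in> C} v \<partial>M)"
      by (intro Bochner_Integration.integral_cong) (auto simp: indicator_def)
    then show "(\<integral>v. indicat_real C (V v, t) \<partial>M) = prob {v \<in> space M. (V v, t) \<in> C}"
      using ev by simp
  qed
  finally show ?thesis .
qed

text \<open>The freezing principle: conditioning on \<open>T\<close> fixes its value and leaves the
  law of the independent \<open>V\<close> unchanged. It turns the error conditional on the training
  data into the error of a deterministic rule.\<close>

lemma cond_prob_rv_product_distr: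
  assumes V[measurable]: "V \<in> M \<rightarrow>\<^sub>M S" and T[measurable]: "T \<in> M \<rightarrow>\<^sub>M N"
    and ind: "distr M S V \<Otimes>\<^sub>M distr M N T = distr M (S \<Otimes>\<^sub>M N) (\<lambda>w. (V w, T w))"
    and C: "C \<in> sets (S \<Otimes>\<^sub>M N)"
  shows "AE w in M. cond_prob_rv M N T {w \<in> space M. (V w, T w) \<in> C} w =
           prob {v \<in> space M. (V v, T w) \<in> C}"
proof -
  note C[measurable]
  interpret S: sigma_finite_subalgebra M "vimage_algebra (space M) T N"
    by (rule sigma_finite_vimage_subalgebra[OF T])
  define E where "E = {w \<in> space M. (V w, T w) \<in> C}"
  have E[measurable]: "E \<in> events" unfolding E_def by measurable
  define R where "R t = prob {v \<in> space M. (V v, t) \<in> C}" for t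
  have R: "R \<in> borel_measurable N"
    unfolding R_def by (rule borel_measurable_prob_section[OF V C])
  have RT[measurable]: "(\<lambda>w. R (T w)) \<in> borel_measurable M" by (rule measurable_compose[OF T R])
  have R01: "0 \<le> R t" "R t \<le> 1" for t by (auto simp: R_def)
  have "AE w in M. real_cond_exp M (vimage_algebra (space M) T N) (indicator E) w = R (T w)"
  \<comment> \<open>Conditional expectation is characterised by measurability with respect to
    \<open>T\<close> together with equal integrals over every set of the sigma-algebra generated by
    \<open>T\<close>.\<close>
  proof (rule S.real_cond_exp_charact)
    show "integrable M (indicator E :: 'a \<Rightarrow> real)" by (simp add: emeasure_eq_measure)
    show "integrable M (\<lambda>w. R (T w))"
      by (rule integrable_const_bound[where B = 1]) (use R01 in auto)
    show "(\<lambda>w. R (T w)) \<in> borel_measurable (vimage_algebra (space M) T N)"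
      by (rule measurable_compose[OF measurable_vimage_algebra1 R]) (use measurable_space[OF T] in auto)
    fix A assume "A \<in> sets (vimage_algebra (space M) T N)"
    then obtain B where B[measurable]: "B \<in> sets N" and A: "A = T -` B \<inter> space M"
      using measurable_space[OF T] by (subst (asm) sets_vimage_algebra2) auto
    have A'[measurable]: "A \<in> events" unfolding A by measurable
    \<comment> \<open>Every such set is a preimage of some \<open>B\<close>, so integrating over it
      is multiplication by a function of \<open>T\<close>. Values in \<open>ennreal\<close> let
      Tonelli apply directly; nonnegativity brings the identity back to the reals at the
      end.\<close>
    define f where "f = (\<lambda>(v, t). indicator C (v, t) * indicator B t :: ennreal)"
    have f: "f \<in> borel_measurable (S \<Otimes>\<^sub>M N)" unfolding f_def by measurable
    have "ennreal (\<integral>w\<in>A. indicator E w \<partial>M) = ennreal (\<integral>w. indicator (A \<inter> E) w \<partial>M)"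
      unfolding set_lebesgue_integral_def
      by (intro arg_cong[where f = ennreal] Bochner_Integration.integral_cong) (auto simp: indicator_def)
    also have "\<dots> = emeasure M (A \<inter> E)" by (simp add: emeasure_eq_measure)
    also have "\<dots> = (\<integral>\<^sup>+w. indicator (A \<inter> E) w \<partial>M)" by simp
    also have "\<dots> = (\<integral>\<^sup>+w. f (V w, T w) \<partial>M)"
      by (intro nn_integral_cong) (auto simp: indicator_def f_def A E_def)
    also have "\<dots> = (\<integral>\<^sup>+w. (\<integral>\<^sup>+v. f (V v, T w) \<partial>M) \<partial>M)"
      by (rule nn_integral_product_distr[OF V T ind f])
    also have "\<dots> = (\<integral>\<^sup>+w. ennreal (indicator A w * R (T w)) \<partial>M)"
    proof (intro nn_integral_cong)
      fix w assume w: "w \<in> space M"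
      then have t: "T w \<in> space N" by (rule measurable_space[OF T])
      have ev: "{v \<in> space M. (V v, T w) \<in> C} \<in> events"
        using t by measurable
      have "(\<integral>\<^sup>+v. f (V v, T w) \<partial>M) = (\<integral>\<^sup>+v. indicator A w * indicator {v \<in> space M. (V v, T w) \<in> C} v \<partial>M)"
        using w by (intro nn_integral_cong) (auto simp: f_def A indicator_def)
      also have "\<dots> = indicator A w * emeasure M {v \<in> space M. (V v, T w) \<in> C}"
        using ev by (simp add: nn_integral_cmult)
      also have "\<dots> = ennreal (indicator A w * R (T w))"
        by (auto simp: indicator_def R_def emeasure_eq_measure)
      finally show "(\<integral>\<^sup>+v. f (V v, T w) \<partial>M) = ennreal (indicator A w * R (T w))" .
    qed
    also have "\<dots> = ennreal (\<integral>w\<in>A. R (T w) \<partial>M)"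
    proof -
      have "integrable M (\<lambda>w. indicator A w * R (T w))"
        by (rule integrable_const_bound[where B = 1]) (use R01 in \<open>auto simp: indicator_def\<close>)
      then show ?thesis unfolding set_lebesgue_integral_def
        using R01 by (subst nn_integral_eq_integral) auto
    qed
    finally show "(\<integral>w\<in>A. indicator E w \<partial>M) = (\<integral>w\<in>A. R (T w) \<partial>M)"
      by (subst (asm) ennreal_inj) (auto simp: set_lebesgue_integral_def R01 intro!: integral_nonneg_AE)
  qed
  then show ?thesis by (simp add: cond_prob_rv_def E_def R_def)
qed

section \<open>Effect of symmetric noise on the class probabilities\<close>

text \<open>Tower property: the noise model gives the law of \<open>Z\<close> given
  \<open>(X, Y)\<close>, which is affine in the indicator of \<open>Y = k\<close>; conditioning
  further on \<open>X\<close> turns that indicator into \<open>p\<close>.\<close>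

lemma symmetric_noise_cond_prob:
  fixes X :: "'a \<Rightarrow> real^'d"
  assumes X: "X \<in> M \<rightarrow>\<^sub>M borel" and Y: "Y \<in> M \<rightarrow>\<^sub>M labels K" and Z: "Z \<in> M \<rightarrow>\<^sub>M labels K"
    and K: "K \<ge> 2" and k: "k \<in> {1..K}"
    and noise: "symmetric_label_noise M K \<alpha> X Y Z"
    and p: "is_cond_prob_at M borel X {w \<in> space M. Y w = k} p"
    and q: "is_cond_prob_at M borel X {w \<in> space M. Z w = k} q"
  shows "AE w in M. q (X w) = \<alpha> / (real K - 1) + (1 - \<alpha> * real K / (real K - 1)) * p (X w)"
proof -
  define a where "a = \<alpha> / (real K - 1)"
  define b where "b = 1 - \<alpha> * real K / (real K - 1)"
  \<comment> \<open>Hence the two noise probabilities are \<open>a + b * 1\<close> for the true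
    label and \<open>a + b * 0\<close> for any other one.\<close>
  have b: "1 - \<alpha> = a + b"
  proof -
    have "\<alpha> / (real K - 1) - \<alpha> * real K / (real K - 1) = - \<alpha> * (real K - 1) / (real K - 1)"
      by (simp add: algebra_simps flip: diff_divide_distrib)
    then show ?thesis using K by (simp add: a_def b_def)
  qed
  have Ev: "{w \<in> space M. W w = k} \<in> events" if "W \<in> M \<rightarrow>\<^sub>M labels K" for W
    using measurable_sets[OF that, of "{k}"] k by (simp add: vimage_def Int_def conj_commute)
  have XY: "(\<lambda>w. (X w, Y w)) \<in> M \<rightarrow>\<^sub>M borel \<Otimes>\<^sub>M labels K"
    using X Y by (rule measurable_Pair)
  define F where "F = vimage_algebra (space M) X borel"
  define G where "G = vimage_algebra (space M) (\<lambda>w. (X w, Y w)) (borel \<Otimes>\<^sub>M labels K)"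
  interpret F: sigma_finite_subalgebra M F
    unfolding F_def by (rule sigma_finite_vimage_subalgebra[OF X])
  have MG: "subalgebra M G" unfolding G_def by (rule vimage_algebra_subalgebra[OF XY])
  have "(\<lambda>w. (X w, Y w)) \<in> G \<rightarrow>\<^sub>M borel \<Otimes>\<^sub>M labels K"
    unfolding G_def using measurable_space[OF XY] by (intro measurable_vimage_algebra1) auto
  then have "X \<in> G \<rightarrow>\<^sub>M borel"
    using measurable_compose[OF _ measurable_fst] by fastforce
  \<comment> \<open>The sigma-algebra of \<open>X\<close> lies inside that of \<open>(X, Y)\<close>,
    as nested conditioning requires.\<close>
  from vimage_algebra_subalgebra[OF this] have GF: "subalgebra G F"
    by (simp add: F_def G_def)
  let ?y = "indicat_real {w \<in> space M. Y w = k}" and ?z = "indicat_real {w \<in> space M. Z w = k}"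
  have y: "integrable M ?y" and z: "integrable M ?z"
    using Ev[OF Y] Ev[OF Z] by (simp_all add: emeasure_eq_measure)
  have zG: "AE w in M. real_cond_exp M G ?z w = a + b * ?y w"
    using noise[unfolded symmetric_label_noise_def cond_prob_rv_def, rule_format, OF k] AE_space
    unfolding G_def[symmetric] by eventually_elim (auto simp: b a_def[symmetric])
  have "AE w in M. real_cond_exp M F ?z w = real_cond_exp M F (real_cond_exp M G ?z) w"
    using F.real_cond_exp_nested_subalg[OF MG GF z] by eventually_elim simp
  moreover have "AE w in M. real_cond_exp M F (real_cond_exp M G ?z) w = real_cond_exp M F (\<lambda>w. a + b * ?y w) w"
    by (rule F.real_cond_exp_cong[OF zG]) (use y in auto)
  moreover have "AE w in M. real_cond_exp M F (\<lambda>w. a + b * ?y w) w =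
      real_cond_exp M F (\<lambda>_. a) w + real_cond_exp M F (\<lambda>w. b * ?y w) w"
    by (rule F.real_cond_exp_add) (use y in auto)
  moreover have "AE w in M. real_cond_exp M F (\<lambda>_. a) w = a"
    by (rule F.real_cond_exp_F_meas) auto
  moreover have "AE w in M. real_cond_exp M F (\<lambda>w. b * ?y w) w = b * real_cond_exp M F ?y w"
    by (rule F.real_cond_exp_cmult[OF y])
  moreover have "AE w in M. p (X w) = real_cond_exp M F ?y w" "AE w in M. q (X w) = real_cond_exp M F ?z w"
    using p q by (auto simp: is_cond_prob_at_def cond_prob_rv_def F_def)
  ultimately show ?thesis
    unfolding a_def[symmetric] b_def[symmetric] by eventually_elim simp
qed

section \<open>Bayes optimality and excess error of a plug-in rule\<close>

text \<open>The error is one minus the integral of the selected class probability, and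
  \<open>gs\<close> maximises that integrand at every point.\<close>

lemma classification_error_arg_max_le:
  assumes X: "X \<in> M \<rightarrow>\<^sub>M N" and Y: "Y \<in> M \<rightarrow>\<^sub>M labels K"
    and p: "\<And>k. k \<in> {1..K} \<Longrightarrow> is_cond_prob_at M N X {w \<in> space M. Y w = k} (p k)"
    and gs: "gs \<in> N \<rightarrow>\<^sub>M labels K" and g: "g \<in> N \<rightarrow>\<^sub>M labels K"
    and gs_max: "\<And>x. is_arg_max (\<lambda>k. p k x) (\<lambda>k. k \<in> {1..K}) (gs x)"
  shows "classification_error M X Y gs \<le> classification_error M X Y g"
proof -
  have "(\<integral>w. p (g (X w)) (X w) \<partial>M) \<le> (\<integral>w. p (gs (X w)) (X w) \<partial>M)"
    using measurable_space[OF g] measurable_space[OF X] gs_max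
    by (intro integral_mono integrable_cond_prob_at_select(1)[OF X Y] gs g p)
       (auto simp: is_arg_max_linorder)
  then show ?thesis
    using integrable_cond_prob_at_select(2)[OF X Y gs p] integrable_cond_prob_at_select(2)[OF X Y g p]
    by simp
qed

text \<open>At a point where the rules differ, the affine relation makes \<open>b\<close> times the
  regret a difference of two \<open>q\<close> values. As \<open>g\<close> prefers its own label
  under the scores \<open>r\<close>, this difference is at most the sum of the estimation errors at
  the two labels.\<close>

lemma plug_in_excess_error_le:
  assumes X: "X \<in> M \<rightarrow>\<^sub>M N" and Y: "Y \<in> M \<rightarrow>\<^sub>M labels K"
    and p: "\<And>k. k \<in> {1..K} \<Longrightarrow> is_cond_prob_at M N X {w \<in> space M. Y w = k} (p k)"
    and gs: "gs \<in> N \<rightarrow>\<^sub>M labels K" and g: "g \<in> N \<rightarrow>\<^sub>M labels K"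
    and gs_max: "\<And>x. is_arg_max (\<lambda>k. p k x) (\<lambda>k. k \<in> {1..K}) (gs x)"
    and g_max: "\<And>x. is_arg_max (\<lambda>k. r k x) (\<lambda>k. k \<in> {1..K}) (g x)"
    and b: "0 \<le> b"
    and q: "\<And>k. k \<in> {1..K} \<Longrightarrow> AE w in M. q k (X w) = a + b * p k (X w)"
  shows "ennreal (b * (classification_error M X Y g - classification_error M X Y gs))
    \<le> (\<integral>\<^sup>+w. ennreal (\<Sum>k=1..K. \<bar>r k (X w) - q k (X w)\<bar>) \<partial>M)"
proof -
  let ?d = "\<lambda>w. b * (p (gs (X w)) (X w) - p (g (X w)) (X w))"
  note int = integrable_cond_prob_at_select(1)[OF X Y gs p] integrable_cond_prob_at_select(1)[OF X Y g p]
  have gsK: "gs x \<in> {1..K}" and gK: "g x \<in> {1..K}" for x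
    using gs_max[of x] g_max[of x] by (auto simp: is_arg_max_linorder)
  have "ennreal (b * (classification_error M X Y g - classification_error M X Y gs)) =
      ennreal (\<integral>w. ?d w \<partial>M)"
    using int integrable_cond_prob_at_select(2)[OF X Y gs p] integrable_cond_prob_at_select(2)[OF X Y g p]
    by simp
  \<comment> \<open>The integrand is nonnegative because \<open>gs\<close> maximises
    \<open>p\<close> and \<open>b\<close> is nonnegative.\<close>
  also have "\<dots> = (\<integral>\<^sup>+w. ennreal (?d w) \<partial>M)"
    using int gs_max gK b
    by (intro nn_integral_eq_integral[symmetric]) (auto simp: is_arg_max_linorder)
  also have "\<dots> \<le> (\<integral>\<^sup>+w. ennreal (\<Sum>k=1..K. \<bar>r k (X w) - q k (X w)\<bar>) \<partial>M)"
  proof (rule nn_integral_mono_AE)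
    have "AE w in M. \<forall>k\<in>{1..K}. q k (X w) = a + b * p k (X w)"
      using q by (intro AE_finite_allI) auto
    then show "AE w in M. ennreal (?d w) \<le> ennreal (\<Sum>k=1..K. \<bar>r k (X w) - q k (X w)\<bar>)"
    proof eventually_elim
      case (elim w)
      let ?x = "X w"
      show ?case
      proof (cases "gs ?x = g ?x")
        \<comment> \<open>Distinct labels contribute two different summands of the full sum; for
          equal labels the regret vanishes.\<close>
        case False
        have "?d w = q (gs ?x) ?x - q (g ?x) ?x"
          using elim gsK gK by (simp add: algebra_simps)
        also have "\<dots> \<le> \<bar>r (gs ?x) ?x - q (gs ?x) ?x\<bar> + \<bar>r (g ?x) ?x - q (g ?x) ?x\<bar>"
        proof -
          have "r (gs ?x) ?x \<le> r (g ?x) ?x"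
            using g_max gsK by (auto simp: is_arg_max_linorder)
          then show ?thesis by linarith
        qed
        also have "\<dots> = (\<Sum>k\<in>{gs ?x, g ?x}. \<bar>r k ?x - q k ?x\<bar>)"
          using False by simp
        also have "\<dots> \<le> (\<Sum>k=1..K. \<bar>r k ?x - q k ?x\<bar>)"
          using gsK gK by (intro sum_mono2) auto
        finally show ?thesis by (rule ennreal_leI)
      qed simp
    qed
  qed
  finally show ?thesis .
qed

section \<open>Independence of test point and training data\<close>

text \<open>The index blocks {0} and {1..n} are disjoint, so the two restricted families are
  independent. Applying a measurable map to each block, dropping the noisy label of the test triple
  and the true labels of the training triples, preserves the product form.\<close>

lemma iid_noisy_train_product_distr:
  fixes X :: "'a \<Rightarrow> real^'d"
  assumes "iid M (borel \<Otimes>\<^sub>M labels K \<Otimes>\<^sub>M labels K)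
    (\<lambda>(i::nat) w. if i = 0 then (X w, Y w, Z w) else (Xs i w, Ys i w, Zs i w))"
  shows "(\<lambda>w. (X w, Y w)) \<in> M \<rightarrow>\<^sub>M borel \<Otimes>\<^sub>M labels K" (is ?XY)
    and "noisy_train Xs Zs n \<in> M \<rightarrow>\<^sub>M train_space K n" (is ?T)
    and "distr M (borel \<Otimes>\<^sub>M labels K) (\<lambda>w. (X w, Y w)) \<Otimes>\<^sub>M distr M (train_space K n) (noisy_train Xs Zs n) =
      distr M ((borel \<Otimes>\<^sub>M labels K) \<Otimes>\<^sub>M train_space K n) (\<lambda>w. ((X w, Y w), noisy_train Xs Zs n w))" (is ?prod)
proof -
  let ?S = "borel \<Otimes>\<^sub>M labels K \<Otimes>\<^sub>M labels K :: ((real^'d) \<times> nat \<times> nat) measure"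
  let ?V = "\<lambda>(i::nat) w. if i = 0 then (X w, Y w, Z w) else (Xs i w, Ys i w, Zs i w)"
  let ?f = "\<lambda>v. (fst (v (0::nat)), fst (snd (v 0)))"
  let ?h = "\<lambda>v. \<lambda>i\<in>{1..n}. (fst (v i), snd (snd (v i)))"
  have "indep_vars (\<lambda>_. ?S) ?V UNIV"
    using assms by (simp add: iid_def)
  from indep_var_restrict[OF this, of "{0}" "{1..n}"]
  have I: "indep_var (PiM {0} (\<lambda>_. ?S)) (\<lambda>w. \<lambda>i\<in>{0}. ?V i w) (PiM {1..n} (\<lambda>_. ?S)) (\<lambda>w. \<lambda>i\<in>{1..n}. ?V i w)"
    by simp
  define P where "P I = PiM I (\<lambda>_::nat. ?S)" for I
  define U where "U I = (\<lambda>w. \<lambda>i\<in>I. ?V i w)" for I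
  have U: "U {0} \<in> M \<rightarrow>\<^sub>M P {0}" "U {1..n} \<in> M \<rightarrow>\<^sub>M P {1..n}"
    and D: "distr M (P {0}) (U {0}) \<Otimes>\<^sub>M distr M (P {1..n}) (U {1..n}) =
      distr M (P {0} \<Otimes>\<^sub>M P {1..n}) (\<lambda>w. (U {0} w, U {1..n} w))"
    using I by (simp_all add: indep_var_distribution_eq P_def U_def)
  have f: "?f \<in> P {0} \<rightarrow>\<^sub>M borel \<Otimes>\<^sub>M labels K" and h: "?h \<in> P {1..n} \<rightarrow>\<^sub>M train_space K n"
    unfolding P_def by measurable
  have fU: "(\<lambda>w. ?f (U {0} w)) = (\<lambda>w. (X w, Y w))" and hU: "(\<lambda>w. ?h (U {1..n} w)) = noisy_train Xs Zs n"
    by (auto simp: fun_eq_iff noisy_train_def U_def)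
  show ?XY using measurable_compose[OF U(1) f] unfolding fU .
  show ?T using measurable_compose[OF U(2) h] unfolding hU .
  have "distr M (borel \<Otimes>\<^sub>M labels K) (\<lambda>w. ?f (U {0} w)) \<Otimes>\<^sub>M distr M (train_space K n) (\<lambda>w. ?h (U {1..n} w)) =
      distr (distr M (P {0}) (U {0})) (borel \<Otimes>\<^sub>M labels K) ?f \<Otimes>\<^sub>M
      distr (distr M (P {1..n}) (U {1..n})) (train_space K n) ?h"
    using U f h by (simp add: distr_distr comp_def)
  \<comment> \<open>A product of image measures is the image of the product measure under the
    coordinatewise map.\<close>
  also have "\<dots> = distr (distr M (P {0}) (U {0}) \<Otimes>\<^sub>M distr M (P {1..n}) (U {1..n}))
      ((borel \<Otimes>\<^sub>M labels K) \<Otimes>\<^sub>M train_space K n) (\<lambda>(u, v). (?f u, ?h v))"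
    using U f h
    by (intro pair_measure_distr prob_space_imp_sigma_finite prob_space.prob_space_distr prob_space_distr) auto
  also have "\<dots> = distr M ((borel \<Otimes>\<^sub>M labels K) \<Otimes>\<^sub>M train_space K n) (\<lambda>w. (?f (U {0} w), ?h (U {1..n} w)))"
    unfolding D using U f h by (subst distr_distr) (auto simp: comp_def)
  finally show ?prod
    by (simp only: fU hU fun_cong[OF fU] fun_cong[OF hU])
qed

end

section \<open>Convergence in probability of the conditional error\<close>

theorem theorem1:
  fixes M :: "'w measure"
    and K :: nat and \<alpha> :: real
    and X :: "'w \<Rightarrow> real^'d" and Y Z :: "'w \<Rightarrow> nat"
    and Xs :: "nat \<Rightarrow> 'w \<Rightarrow> real^'d" and Ys Zs :: "nat \<Rightarrow> 'w \<Rightarrow> nat"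
    and p q :: "nat \<Rightarrow> real^'d \<Rightarrow> real"
    and qn :: "nat \<Rightarrow> nat \<Rightarrow> real^'d \<Rightarrow> (nat \<Rightarrow> (real^'d) \<times> nat) \<Rightarrow> real"
    and gn :: "nat \<Rightarrow> real^'d \<Rightarrow> (nat \<Rightarrow> (real^'d) \<times> nat) \<Rightarrow> nat"
    and gstar :: "real^'d \<Rightarrow> nat"
  assumes "prob_space M"
    and "K \<ge> 2" and "0 \<le> \<alpha>" and "\<alpha> \<le> 1"
    \<comment> \<open>index 0 carries the test triple, index i \<ge> 1 the i-th training triple\<close>
    and "iid M (borel \<Otimes>\<^sub>M labels K \<Otimes>\<^sub>M labels K)
           (\<lambda>(i::nat) w. if i = 0 then (X w, Y w, Z w) else (Xs i w, Ys i w, Zs i w))"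
    and "symmetric_label_noise M K \<alpha> X Y Z"
    and "\<And>k. k \<in> {1..K} \<Longrightarrow> is_cond_prob_at M borel X {w \<in> space M. Y w = k} (p k)"
    and "\<And>k. k \<in> {1..K} \<Longrightarrow> is_cond_prob_at M borel X {w \<in> space M. Z w = k} (q k)"
    and "gstar \<in> borel \<rightarrow>\<^sub>M labels K"
    and "\<And>x. is_arg_max (\<lambda>k. p k x) (\<lambda>k. k \<in> {1..K}) (gstar x)"
    and "\<And>k n. k \<in> {1..K} \<Longrightarrow> n \<ge> 1 \<Longrightarrow>
           (\<lambda>(x, t). qn k n x t) \<in> borel_measurable (borel \<Otimes>\<^sub>M train_space K n)"
    \<comment> \<open>expectation of a nonnegative quantity, taken in [0, \<infinity>]\<close>
    and "(\<lambda>n. \<integral>\<^sup>+ w. ennreal (\<Sum>k=1..K. \<bar>qn k n (X w) (noisy_train Xs Zs n w) - q k (X w)\<bar>) \<partial>M)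
           \<longlonglongrightarrow> 0"
    and "\<And>n. n \<ge> 1 \<Longrightarrow>
           (\<lambda>(x, t). gn n x t) \<in> (borel \<Otimes>\<^sub>M train_space K n) \<rightarrow>\<^sub>M labels K"
    and "\<And>n x t. n \<ge> 1 \<Longrightarrow> t \<in> space (train_space K n) \<Longrightarrow>
           is_arg_max (\<lambda>k. qn k n x t) (\<lambda>k. k \<in> {1..K}) (gn n x t)"
    and "\<alpha> < (real K - 1) / real K"
  shows "tendsto_in_prob M
           (\<lambda>n. cond_prob_rv M (train_space K n) (noisy_train Xs Zs n)
                  {w \<in> space M. gn n (X w) (noisy_train Xs Zs n w) \<noteq> Y w})
           (classification_error M X Y gstar)"
proof -
  interpret prob_space M by fact
  note iid = assms(5) and noise = assms(6) and p = assms(7) and q = assms(8)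
    and gstar = assms(9) and gstar_max = assms(10) and qn = assms(11) and cons = assms(12)
    and gn = assms(13) and gn_max = assms(14)
  let ?S = "borel \<Otimes>\<^sub>M labels K :: ((real^'d) \<times> nat) measure"
  let ?T = "\<lambda>n. noisy_train Xs Zs n"
  define L where "L = classification_error M X Y gstar"
  define a where "a = \<alpha> / (real K - 1)"
  define b where "b = 1 - \<alpha> * real K / (real K - 1)"
  \<comment> \<open>The bound on \<alpha> enters here; \<open>K \<ge> 2\<close> makes the
    denominator positive.\<close>
  have b: "b > 0"
    using \<open>\<alpha> < (real K - 1) / real K\<close> \<open>K \<ge> 2\<close> by (simp add: b_def field_simps)
  have V0: "(\<lambda>w. (X w, Y w, Z w)) \<in> M \<rightarrow>\<^sub>M borel \<Otimes>\<^sub>M labels K \<Otimes>\<^sub>M labels K"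
  proof -
    have "\<forall>i::nat. (\<lambda>w. if i = 0 then (X w, Y w, Z w) else (Xs i w, Ys i w, Zs i w))
        \<in> M \<rightarrow>\<^sub>M borel \<Otimes>\<^sub>M labels K \<Otimes>\<^sub>M labels K"
      using iid unfolding iid_def indep_vars_def by blast
    from spec[OF this, of 0] show ?thesis by simp
  qed
  have X: "X \<in> M \<rightarrow>\<^sub>M borel" and Y: "Y \<in> M \<rightarrow>\<^sub>M labels K" and Z: "Z \<in> M \<rightarrow>\<^sub>M labels K"
    using measurable_compose[OF V0 measurable_fst]
      measurable_compose[OF measurable_compose[OF V0 measurable_snd] measurable_fst]
      measurable_compose[OF measurable_compose[OF V0 measurable_snd] measurable_snd] by simp_all
  have qp: "AE w in M. q k (X w) = a + b * p k (X w)" if "k \<in> {1..K}" for k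
    unfolding a_def b_def by (rule symmetric_noise_cond_prob[OF X Y Z \<open>K \<ge> 2\<close> that noise p[OF that] q[OF that]])
  have qm: "q k \<in> borel_measurable borel" if "k \<in> {1..K}" for k
    using q[OF that] by (simp add: is_cond_prob_at_def)
  define e where "e n = (\<integral>\<^sup>+w. ennreal (\<Sum>k=1..K. \<bar>qn k n (X w) (?T n w) - q k (X w)\<bar>) \<partial>M)" for n
  define D where "D n = cond_prob_rv M (train_space K n) (?T n)
    {w \<in> space M. gn n (X w) (?T n w) \<noteq> Y w}" for n
  have markov: "emeasure M {w \<in> space M. \<bar>D n w - L\<bar> > \<epsilon>} \<le> ennreal (1 / (b * \<epsilon>)) * e n"
    if n: "n \<ge> 1" and \<epsilon>: "\<epsilon> > 0" for n \<epsilon>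
  proof -
    note ind = iid_noisy_train_product_distr(3)[OF iid]
      and XY = iid_noisy_train_product_distr(1)[OF iid]
      and T = iid_noisy_train_product_distr(2)[OF iid]
    note T[measurable]
    have proj: "(\<lambda>z. (fst (fst z), snd z)) \<in> ?S \<Otimes>\<^sub>M train_space K n \<rightarrow>\<^sub>M borel \<Otimes>\<^sub>M train_space K n"
      by measurable
    \<comment> \<open>The consistency integrand, constant in the label \<open>y\<close>:
      independence is available for the pair \<open>(X, Y)\<close> against the training data, so it
      is placed on that product space.\<close>
    define f where "f = (\<lambda>((x, y::nat), t). ennreal (\<Sum>k=1..K. \<bar>qn k n x t - q k x\<bar>))"
    have f[measurable]: "f \<in> borel_measurable (?S \<Otimes>\<^sub>M train_space K n)"
    proof -
      have "(\<lambda>((x, y::nat), t). qn k n x t) \<in> borel_measurable (?S \<Otimes>\<^sub>M train_space K n)" if "k \<in> {1..K}" for k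
        using measurable_compose[OF proj qn[OF that n]]
        by (simp add: case_prod_beta')
      moreover have "(\<lambda>((x, y::nat), t). q k x) \<in> borel_measurable (?S \<Otimes>\<^sub>M train_space K n)" if "k \<in> {1..K}" for k
        using measurable_compose[OF measurable_compose[OF proj measurable_fst] qm[OF that]]
        by (simp add: case_prod_beta')
      ultimately show ?thesis
        unfolding f_def case_prod_beta'
        by (intro measurable_compose[OF _ measurable_ennreal] borel_measurable_sum borel_measurable_abs
            borel_measurable_diff) auto
    qed
    \<comment> \<open>The L1 estimation error for frozen training data \<open>t\<close>; by Tonelli
      its mean over the training data is \<open>e n\<close>.\<close>
    define h where "h t = (\<integral>\<^sup>+v. f ((X v, Y v), t) \<partial>M)" for t
    have h[measurable]: "h \<in> borel_measurable (train_space K n)"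
      unfolding h_def using X Y by measurable
    have he: "(\<integral>\<^sup>+w. h (?T n w) \<partial>M) = e n"
      using nn_integral_product_distr[OF XY T ind f] by (simp add: h_def e_def f_def)
    define C where "C = {z \<in> space (?S \<Otimes>\<^sub>M train_space K n). gn n (fst (fst z)) (snd z) \<noteq> snd (fst z)}"
    have C: "C \<in> sets (?S \<Otimes>\<^sub>M train_space K n)"
    proof -
      \<comment> \<open>Labels are embedded in the reals so that the disagreement set of two
        measurable functions is measurable.\<close>
      have "(\<lambda>z. real (gn n (fst (fst z)) (snd z))) \<in> borel_measurable (?S \<Otimes>\<^sub>M train_space K n)"
        using measurable_compose[OF measurable_compose[OF proj gn[OF n]], of real borel] by simp
      moreover have "(\<lambda>z. real (snd (fst z))) \<in> borel_measurable (?S \<Otimes>\<^sub>M train_space K n)"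
        by (rule measurable_compose[OF measurable_compose[OF measurable_fst measurable_snd]]) simp
      ultimately have "{z \<in> space (?S \<Otimes>\<^sub>M train_space K n). real (gn n (fst (fst z)) (snd z)) \<noteq> real (snd (fst z))}
          \<in> sets (?S \<Otimes>\<^sub>M train_space K n)"
        by (rule borel_measurable_neq)
      then show ?thesis by (simp add: C_def)
    qed
    have XYs: "(X w, Y w) \<in> space ?S" if "w \<in> space M" for w
      using measurable_space[OF XY that] .
    have Ts: "?T n w \<in> space (train_space K n)" if "w \<in> space M" for w
      using measurable_space[OF T that] .
    have E: "{w \<in> space M. ((X w, Y w), ?T n w) \<in> C} = {w \<in> space M. gn n (X w) (?T n w) \<noteq> Y w}"
      using XYs Ts by (auto simp: C_def space_pair_measure)
    have E': "{v \<in> space M. ((X v, Y v), t) \<in> C} = {v \<in> space M. gn n (X v) t \<noteq> Y v}"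
      if "t \<in> space (train_space K n)" for t
      using XYs that by (auto simp: C_def space_pair_measure)
    have D: "AE w in M. D n w = classification_error M X Y (\<lambda>x. gn n x (?T n w))"
      using cond_prob_rv_product_distr[OF XY T ind C] AE_space unfolding E
      by eventually_elim (simp only: D_def classification_error_def E'[OF Ts])
    have bound: "L \<le> classification_error M X Y (\<lambda>x. gn n x t)"
        "ennreal (b * (classification_error M X Y (\<lambda>x. gn n x t) - L)) \<le> h t"
      if t: "t \<in> space (train_space K n)" for t
    proof -
      have g: "(\<lambda>x. gn n x t) \<in> borel \<rightarrow>\<^sub>M labels K"
        using measurable_compose[OF measurable_Pair2'[OF t] gn[OF n]] by simp
      show "L \<le> classification_error M X Y (\<lambda>x. gn n x t)"
        unfolding L_def by (rule classification_error_arg_max_le[OF X Y p gstar g gstar_max])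
      show "ennreal (b * (classification_error M X Y (\<lambda>x. gn n x t) - L)) \<le> h t"
        unfolding L_def h_def f_def prod.case
        by (rule plug_in_excess_error_le[OF X Y p gstar g gstar_max gn_max[OF n t] _ qp])
           (use b in auto)
    qed
    have "emeasure M {w \<in> space M. \<bar>D n w - L\<bar> > \<epsilon>} \<le>
        emeasure M {w \<in> space M. 1 \<le> ennreal (1 / (b * \<epsilon>)) * h (?T n w)}"
    proof (rule emeasure_mono_AE)
      show "AE w in M. w \<in> {w \<in> space M. \<bar>D n w - L\<bar> > \<epsilon>} \<longrightarrow>
          w \<in> {w \<in> space M. 1 \<le> ennreal (1 / (b * \<epsilon>)) * h (?T n w)}"
        using D AE_space
      proof eventually_elim
        case (elim w)
        show ?case
        proof safe
          assume "\<bar>D n w - L\<bar> > \<epsilon>"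
          \<comment> \<open>Bayes optimality removes the absolute value.\<close>
          then have "\<epsilon> \<le> D n w - L" using bound(1)[OF Ts[OF elim(2)]] elim(1) by simp
          \<comment> \<open>Markov's inequality is used in the normalised form with threshold 1; the
            factor \<open>1 / (b * \<epsilon>)\<close> absorbs both \<epsilon> and the contraction
            \<open>b\<close> caused by the noise.\<close>
          then have "1 \<le> 1 / (b * \<epsilon>) * (b * (D n w - L))"
            using b \<epsilon> by (simp add: pos_le_divide_eq)
          then have "1 \<le> ennreal (1 / (b * \<epsilon>) * (b * (D n w - L)))" by simp
          also have "\<dots> = ennreal (1 / (b * \<epsilon>)) * ennreal (b * (D n w - L))"
            using b \<epsilon> by (intro ennreal_mult') simp
          also have "\<dots> \<le> ennreal (1 / (b * \<epsilon>)) * h (?T n w)"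
            using bound(2)[OF Ts[OF elim(2)]] elim(1) by (intro mult_left_mono) simp_all
          finally show "1 \<le> ennreal (1 / (b * \<epsilon>)) * h (?T n w)" .
        qed
      qed
      show "{w \<in> space M. 1 \<le> ennreal (1 / (b * \<epsilon>)) * h (?T n w)} \<in> events" by measurable
    qed
    also have "\<dots> \<le> ennreal (1 / (b * \<epsilon>)) * (\<integral>\<^sup>+w. h (?T n w) * indicator (space M) w \<partial>M)"
      by (rule nn_integral_Markov_inequality) auto
    also have "(\<integral>\<^sup>+w. h (?T n w) * indicator (space M) w \<partial>M) = e n"
      unfolding he[symmetric] by (intro nn_integral_cong) simp
    finally show ?thesis .
  qed
  have "(\<lambda>n. measure M {w \<in> space M. \<bar>D n w - L\<bar> > \<epsilon>}) \<longlonglongrightarrow> 0" if \<epsilon>: "\<epsilon> > 0" for \<epsilon>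
  proof -
    have "(\<lambda>n. ennreal (1 / (b * \<epsilon>)) * e n) \<longlonglongrightarrow> ennreal (1 / (b * \<epsilon>)) * 0"
      using cons unfolding e_def by (intro ennreal_tendsto_cmult) auto
    then have lim: "(\<lambda>n. ennreal (1 / (b * \<epsilon>)) * e n) \<longlonglongrightarrow> 0" by simp
    have "(\<lambda>n. emeasure M {w \<in> space M. \<bar>D n w - L\<bar> > \<epsilon>}) \<longlonglongrightarrow> 0"
      \<comment> \<open>The Markov bound is available from sample size 1 on, hence the squeeze holds
        eventually.\<close>
      by (rule tendsto_sandwich[OF _ eventually_sequentiallyI[of 1, OF markov[OF _ \<epsilon>]] tendsto_const lim]) simp_all
    then show ?thesis
      unfolding emeasure_eq_measure by (simp only: ennreal_tendsto_0_iff[OF measure_nonneg])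
  qed
  then show ?thesis
    by (simp add: tendsto_in_prob_def D_def L_def)
qed

end
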